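(* Every (possibly randomized) matching mechanism has worst-case distortion $\Omega(\log n)$. That is, there is an absolute constant $c>0$ such that for every $n\ge 2$ and every randomized matching mechanism (deterministic ones included) for $n$ agents and $n$ items, there exist an ordinal matching problem instance with $n$ agents and $n$ items and a metric $d$ consistent with it, with $\mathrm{cost}_d(M_{\mathrm{OPT}})>0$, such that the fractional matching $(p_{i,j})$ output by the mechanism on this instance satisfies $$\sum_{i=1}^n\sum_{j=1}^n p_{i,j}\,d(a_i,b_j)\ \ge\ c\,\log n\cdot \mathrm{cost}_d(M_{\mathrm{OPT}}),$$ where $M_{\mathrm{OPT}}$ is a minimum-cost perfect matching with respect to $d$.
   Context: Agents $A=\{a_1,\dots,a_n\}$ and items $B=\{b_1,\dots,b_n\}$. A metric is a function $d:(A\cup B)\times(A\cup B)\to\mathbb{R}_{\ge 0}$ with $d(x,x)=0$, $d(x,y)=d(y,x)$ and $d(x,y)\le d(x,z)+d(z,y)$ (distinct points are allowed to be at distance $0$). An ordinal matching problem instance consists of $n$ preference lists, one per agent; each list is a permutation of $B$. A metric $d$ is consistent with the instance if, for every agent $a_i$, whenever $b_j$ appears before $b_k$ in the list of $a_i$ we have $d(a_i,b_j)\le d(a_i,b_k)$ (each list is in increasing order of distance, ties broken arbitrarily). A perfect matching is a bijection $M:A\to B$, and $\mathrm{cost}_d(M)=\sum_{i=1}^n d(a_i,M(a_i))$. A randomized matching mechanism maps each instance (it sees only the preference lists, not $d$) to a probability distribution over perfect matchings, equivalently for cost purposes to a fractional matching: nonnegative reals $p_{i,j}$, $i,j\in[n]$,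 with $\sum_i p_{i,j}=1$ for all $j$ and $\sum_j p_{i,j}=1$ for all $i$ ($p_{i,j}$ is the probability that $a_i$ is matched to $b_j$). Its expected cost is $\sum_{i,j}p_{i,j}d(a_i,b_j)$. The worst-case distortion of the mechanism is the maximum, over all instances and consistent metrics, of the expected cost divided by $\mathrm{cost}_d(M_{\mathrm{OPT}})$. *)

theory Defs
  imports "HOL-Probability.Probability"
begin

text \<open>Agents and items are both indexed by \<open>{..<n}\<close>, as two disjoint families of points.\<close>

datatype point = Agent nat | Item nat

definition points :: "nat \<Rightarrow> point set" where
  "points n = Agent ` {..<n} \<union> Item ` {..<n}"

text \<open>Distinct points may be at distance 0, so \<open>Metric_space\<close> of the library does not apply.\<close>

definition is_metric :: "nat \<Rightarrow> (point \<Rightarrow> point \<Rightarrow> real) \<Rightarrow> bool" where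
  "is_metric n d \<longleftrightarrow>
     (\<forall>x\<in>points n. \<forall>y\<in>points n. 0 \<le> d x y) \<and>
     (\<forall>x\<in>points n. d x x = 0) \<and>
     (\<forall>x\<in>points n. \<forall>y\<in>points n. d x y = d y x) \<and>
     (\<forall>x\<in>points n. \<forall>y\<in>points n. \<forall>z\<in>points n. d x y \<le> d x z + d z y)"

text \<open>\<open>P ! i\<close> is the preference list of agent \<open>i\<close>, most preferred item first.\<close>

definition is_instance :: "nat \<Rightarrow> nat list list \<Rightarrow> bool" where
  "is_instance n P \<longleftrightarrow> length P = n \<and> (\<forall>L\<in>set P. distinct L \<and> set L = {..<n})"

definition consistent :: "nat \<Rightarrow> nat list list \<Rightarrow> (point \<Rightarrow> point \<Rightarrow> real) \<Rightarrow> bool" where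
  "consistent n P d \<longleftrightarrow>
     (\<forall>i<n. \<forall>r s. r < s \<and> s < n \<longrightarrow>
        d (Agent i) (Item (P ! i ! r)) \<le> d (Agent i) (Item (P ! i ! s)))"

definition perfect_matching :: "nat \<Rightarrow> (nat \<Rightarrow> nat) \<Rightarrow> bool" where
  "perfect_matching n M \<longleftrightarrow> bij_betw M {..<n} {..<n}"

definition cost :: "nat \<Rightarrow> (point \<Rightarrow> point \<Rightarrow> real) \<Rightarrow> (nat \<Rightarrow> nat) \<Rightarrow> real" where
  "cost n d M = (\<Sum>i<n. d (Agent i) (Item (M i)))"

definition min_cost_matching :: "nat \<Rightarrow> (point \<Rightarrow> point \<Rightarrow> real) \<Rightarrow> (nat \<Rightarrow> nat) \<Rightarrow> bool" where
  "min_cost_matching n d M \<longleftrightarrow>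
     perfect_matching n M \<and> (\<forall>M'. perfect_matching n M' \<longrightarrow> cost n d M \<le> cost n d M')"

definition fractional_matching :: "nat \<Rightarrow> (nat \<Rightarrow> nat \<Rightarrow> real) \<Rightarrow> bool" where
  "fractional_matching n p \<longleftrightarrow>
     (\<forall>i<n. \<forall>j<n. 0 \<le> p i j) \<and>
     (\<forall>j<n. (\<Sum>i<n. p i j) = 1) \<and>
     (\<forall>i<n. (\<Sum>j<n. p i j) = 1)"

definition fractional_cost ::
  "nat \<Rightarrow> (point \<Rightarrow> point \<Rightarrow> real) \<Rightarrow> (nat \<Rightarrow> nat \<Rightarrow> real) \<Rightarrow> real" where
  "fractional_cost n d p = (\<Sum>i<n. \<Sum>j<n. p i j * d (Agent i) (Item j))"

definition randomized_mechanism ::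
  "nat \<Rightarrow> (nat list list \<Rightarrow> nat \<Rightarrow> nat \<Rightarrow> real) \<Rightarrow> bool" where
  "randomized_mechanism n f \<longleftrightarrow> (\<forall>P. is_instance n P \<longrightarrow> fractional_matching n (f P))"

text \<open>Any probability distribution over perfect matchings induces a fractional matching whose cost
  is the expected cost, so quantifying over fractional mechanisms covers mechanisms that output
  such distributions (in particular deterministic ones).\<close>

definition marginals :: "(nat \<Rightarrow> nat) pmf \<Rightarrow> nat \<Rightarrow> nat \<Rightarrow> real" where
  "marginals D i j = measure_pmf.prob D {M. M i = j}"

lemma fractional_matching_marginals:
  assumes "\<And>M. M \<in> set_pmf D \<Longrightarrow> perfect_matching n M"
  shows "fractional_matching n (marginals D)"
proof -
  have rows: "(\<Sum>j<n. marginals D i j) = 1" if i: "i < n" for i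
  proof -
    have "(\<Sum>j<n. marginals D i j) = measure_pmf.prob D (\<Union>j<n. {M. M i = j})"
      unfolding marginals_def
      by (subst measure_pmf.finite_measure_finite_Union) (auto simp: disjoint_family_on_def)
    also have "\<dots> = 1"
      using assms i
      by (auto simp: measure_pmf.prob_eq_1 AE_measure_pmf_iff perfect_matching_def bij_betw_def)
    finally show ?thesis .
  qed
  have cols: "(\<Sum>i<n. marginals D i j) = 1" if j: "j < n" for j
  proof -
    have eq: "marginals D i j = measure_pmf.prob D ({M. M i = j} \<inter> set_pmf D)" for i
      by (simp add: marginals_def measure_Int_set_pmf)
    have "disjoint_family_on (\<lambda>i. {M. M i = j} \<inter> set_pmf D) {..<n}"
      using assms
      by (fastforce simp: disjoint_family_on_def perfect_matching_def bij_betw_def inj_on_def)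
    hence "(\<Sum>i<n. marginals D i j) = measure_pmf.prob D (\<Union>i<n. {M. M i = j} \<inter> set_pmf D)"
      unfolding eq by (subst measure_pmf.finite_measure_finite_Union) auto
    also have "\<dots> = 1"
    proof -
      have "\<exists>i<n. M i = j" if "M \<in> set_pmf D" for M
        using assms[OF that] j unfolding perfect_matching_def bij_betw_def
        by (metis imageE lessThan_iff)
      thus ?thesis by (auto simp: measure_pmf.prob_eq_1 AE_measure_pmf_iff)
    qed
    finally show ?thesis .
  qed
  show ?thesis
    using rows cols by (auto simp: fractional_matching_def marginals_def)
qed

lemma expectation_cost_eq_fractional_cost:
  assumes "\<And>M. M \<in> set_pmf D \<Longrightarrow> perfect_matching n M"
  shows "measure_pmf.expectation D (cost n d) = fractional_cost n d (marginals D)"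
proof -
  have "measure_pmf.expectation D (cost n d) =
      measure_pmf.expectation D
        (\<lambda>M. \<Sum>i<n. \<Sum>j<n. indicator {M. M i = j} M * d (Agent i) (Item j))"
  proof (rule integral_cong_AE)
    show "AE M in measure_pmf D. cost n d M =
        (\<Sum>i<n. \<Sum>j<n. indicator {M. M i = j} M * d (Agent i) (Item j))"
    proof (unfold AE_measure_pmf_iff cost_def, intro ballI sum.cong refl)
      fix M i assume M: "M \<in> set_pmf D" and i: "i \<in> {..<n}"
      have "M i < n"
        using assms[OF M] i by (auto simp: perfect_matching_def bij_betw_def)
      moreover have "(\<Sum>j<n. indicator {M. M i = j} M * d (Agent i) (Item j)) =
          (\<Sum>j<n. if M i = j then d (Agent i) (Item j) else 0)"
        by (intro sum.cong) (auto simp: indicator_def)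
      ultimately show "d (Agent i) (Item (M i)) =
          (\<Sum>j<n. indicator {M. M i = j} M * d (Agent i) (Item j))"
        by simp
    qed
  qed auto
  also have "\<dots> = fractional_cost n d (marginals D)"
    unfolding fractional_cost_def marginals_def
    by (subst Bochner_Integration.integral_sum, force intro!: Bochner_Integration.integrable_sum
          integrable_mult_left integrable_real_indicator simp: measure_pmf.emeasure_eq_measure)
       (intro sum.cong refl, subst Bochner_Integration.integral_sum,
        auto intro!: integrable_mult_left integrable_real_indicator
          simp: measure_pmf.emeasure_eq_measure)
  finally show ?thesis .
qed

end

theory Submission
  imports Defs
begin

text \<open>Agents \<open>l, \<dots>, r - 1\<close> are the leaves of a balanced binary tree whose inner nodes, in order,
  are the items \<open>l, \<dots>, r - 2\<close>; the item \<open>n - 1\<close> is put at the end of every list. An agent lists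
  the items of its own half first, then the item at the root, then those of the other half.
  Descend from the root to a leaf \<open>a\<close>. At each node, the half that is left behind together
  with the item at the node is balanced; declare it a cluster of diameter 0, and let any two points
  of different clusters have distance 1. The only nonzero edge of the optimal matching joins \<open>a\<close> to
  the item \<open>n - 1\<close>. Each half has one agent more than it has items, so both halves
  export at least one unit of mass, of which the item at the node absorbs only one unit in total.
  Hence one of the two possible clusters exports at least half a unit, and the descent
  can always be chosen to leave that cluster behind.\<close>

section \<open>Preference lists from the binary tree\<close>

function pref :: "nat \<Rightarrow> nat \<Rightarrow> nat \<Rightarrow> nat list" where
  "pref l r i =
     (if r \<le> Suc l then []
      else let m = (l + r) div 2 in
        if i < m then (pref l m i @ [m - 1]) @ [m..<r - 1]
        else (pref m r i @ [m - 1]) @ [l..<m - 1])"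
  by auto
termination by (relation "Wellfounded.measure (\<lambda>(l, r, i). r - l)") auto

declare pref.simps [simp del]

lemma pref_left:
  "\<lbrakk>Suc l < r; i < (l + r) div 2\<rbrakk> \<Longrightarrow>
    pref l r i = (pref l ((l + r) div 2) i @ [(l + r) div 2 - 1]) @ [(l + r) div 2..<r - 1]"
  by (subst pref.simps) (simp add: Let_def)

lemma pref_right:
  "\<lbrakk>Suc l < r; (l + r) div 2 \<le> i\<rbrakk> \<Longrightarrow>
    pref l r i = (pref ((l + r) div 2) r i @ [(l + r) div 2 - 1]) @ [l..<(l + r) div 2 - 1]"
  by (subst pref.simps) (simp add: Let_def)

lemma pref_set_distinct:
  "set (pref l r i) = {l..<r - 1} \<and> distinct (pref l r i)"
proof (induction l r i rule: pref.induct)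
  case (1 l r i)
  define m where "m = (l + r) div 2"
  show ?case
  proof (cases "r \<le> Suc l")
    case True
    then show ?thesis by (simp add: pref.simps)
  next
    case False
    then have m: "l < m" "m < r" by (auto simp: m_def)
    show ?thesis
    proof (cases "i < m")
      case True
      have "set (pref l m i) = {l..<m - 1} \<and> distinct (pref l m i)"
        using 1(1)[OF False m_def True] .
      moreover have "{l..<r - 1} = {l..<m - 1} \<union> {m - 1} \<union> {m..<r - 1}" using m by auto
      moreover have "pref l r i = (pref l m i @ [m - 1]) @ [m..<r - 1]"
        using True m pref_left[of l r i, folded m_def] by simp
      ultimately show ?thesis using m by auto
    next
      case i: False
      have "set (pref m r i) = {m..<r - 1} \<and> distinct (pref m r i)"
        using 1(2)[OF False m_def i] .
      moreover have "{l..<r - 1} = {l..<m - 1} \<union> {m - 1} \<union> {m..<r - 1}" using m by auto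
      moreover have "pref l r i = (pref m r i @ [m - 1]) @ [l..<m - 1]"
        using i m pref_right[of l r i, folded m_def] by simp
      ultimately show ?thesis using m by auto
    qed
  qed
qed

lemmas set_pref = pref_set_distinct[THEN conjunct1]
lemmas distinct_pref = pref_set_distinct[THEN conjunct2]

section \<open>Fractional mass leaving a set of items\<close>

text \<open>When \<open>Z i\<close> consists of the items in the cluster of agent \<open>i\<close>,
  this is the expected cost paid by the agents in \<open>S\<close>, since leaving a cluster costs
  exactly 1.\<close>

definition cut_mass :: "nat \<Rightarrow> (nat \<Rightarrow> nat \<Rightarrow> real) \<Rightarrow> nat set \<Rightarrow> (nat \<Rightarrow> nat set) \<Rightarrow> real" where
  "cut_mass n p S Z = (\<Sum>i\<in>S. \<Sum>j\<in>{..<n} - Z i. p i j)"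

text \<open>The rows of \<open>S\<close> carry total mass \<open>card S\<close>, and the columns of
  \<open>T\<close> absorb at most 1 each. The column of \<open>b\<close> is kept exact, so that two
  agent sets competing for the same item \<open>b\<close> can later share its single unit.\<close>

lemma cut_mass_lower_bound:
  assumes p: "fractional_matching n p"
    and S: "S \<subseteq> {..<n}" and T: "T \<subseteq> {..<n}" and b: "b < n" "b \<notin> T"
  shows "real (card S) - real (card T) - (\<Sum>i\<in>S. p i b) \<le> cut_mass n p S (\<lambda>_. insert b T)"
proof -
  have fin: "finite S" "finite T" using S T finite_subset by auto
  have "cut_mass n p S (\<lambda>_. insert b T) = (\<Sum>i\<in>S. 1 - (\<Sum>j\<in>insert b T. p i j))"
    unfolding cut_mass_def
  proof (intro sum.cong refl)
    fix i assume "i \<in> S"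
    then have "(\<Sum>j<n. p i j) = 1" using p S by (auto simp: fractional_matching_def)
    moreover have "(\<Sum>j\<in>{..<n} - insert b T. p i j) = (\<Sum>j<n. p i j) - (\<Sum>j\<in>insert b T. p i j)"
      using T b by (intro sum_diff) auto
    ultimately show "(\<Sum>j\<in>{..<n} - insert b T. p i j) = 1 - (\<Sum>j\<in>insert b T. p i j)" by simp
  qed
  also have "\<dots> = real (card S) - (\<Sum>i\<in>S. p i b) - (\<Sum>i\<in>S. \<Sum>j\<in>T. p i j)"
    using fin b by (simp add: sum_subtractf sum.distrib)
  finally have eq: "cut_mass n p S (\<lambda>_. insert b T) = \<dots>" .
  have "(\<Sum>i\<in>S. \<Sum>j\<in>T. p i j) = (\<Sum>j\<in>T. \<Sum>i\<in>S. p i j)" by (rule sum.swap)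
  also have "\<dots> \<le> (\<Sum>j\<in>T. 1)"
  proof (rule sum_mono)
    fix j assume j: "j \<in> T"
    have "(\<Sum>i\<in>S. p i j) \<le> (\<Sum>i<n. p i j)"
      using S T j p by (intro sum_mono2) (auto simp: fractional_matching_def)
    also have "\<dots> = 1" using T j p by (auto simp: fractional_matching_def)
    finally show "(\<Sum>i\<in>S. p i j) \<le> 1" .
  qed
  finally show ?thesis using eq by simp
qed

lemma cut_mass_two_halves:
  assumes p: "fractional_matching n p" and lr: "l < m" "m < r" "r \<le> n"
  shows "1 \<le> cut_mass n p {l..<m} (\<lambda>_. {l..<m}) + cut_mass n p {m..<r} (\<lambda>_. {m - 1..<r - 1})"
proof -
  have "real (card {l..<m}) - real (card {l..<m - 1}) - (\<Sum>i\<in>{l..<m}. p i (m - 1))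
      \<le> cut_mass n p {l..<m} (\<lambda>_. insert (m - 1) {l..<m - 1})"
    using lr by (intro cut_mass_lower_bound[OF p]) auto
  moreover have "insert (m - 1) {l..<m - 1} = {l..<m}" using lr by auto
  moreover have "real (card {m..<r}) - real (card {m..<r - 1}) - (\<Sum>i\<in>{m..<r}. p i (m - 1))
      \<le> cut_mass n p {m..<r} (\<lambda>_. insert (m - 1) {m..<r - 1})"
    using lr by (intro cut_mass_lower_bound[OF p]) auto
  moreover have "insert (m - 1) {m..<r - 1} = {m - 1..<r - 1}" using lr by auto
  \<comment> \<open>Each half has a surplus of one agent, 2 in total; the two halves are disjoint,
    so together they draw at most one unit from item \<open>m - 1\<close>.\<close>
  moreover have "(\<Sum>i\<in>{l..<m}. p i (m - 1)) + (\<Sum>i\<in>{m..<r}. p i (m - 1)) \<le> 1"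
  proof -
    have "(\<Sum>i\<in>{l..<m}. p i (m - 1)) + (\<Sum>i\<in>{m..<r}. p i (m - 1)) = (\<Sum>i\<in>{l..<r}. p i (m - 1))"
      using lr by (intro sum.atLeastLessThan_concat) auto
    also have "\<dots> \<le> (\<Sum>i<n. p i (m - 1))"
      using lr p by (intro sum_mono2) (auto simp: fractional_matching_def)
    also have "\<dots> = 1" using lr p by (auto simp: fractional_matching_def)
    finally show ?thesis .
  qed
  ultimately show ?thesis using lr by (simp add: of_nat_diff)
qed

section \<open>Clusters left behind by a descent\<close>

text \<open>The future optimal matching: a subtree to the left of the leaf \<open>a\<close> is left
  behind with the item just after its own items, one to the right with the item just before
  them.\<close>

definition shift_matching :: "nat \<Rightarrow> nat \<Rightarrow> nat \<Rightarrow> nat" where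
  "shift_matching n a i = (if i < a then i else if i = a then n - 1 else i - 1)"

text \<open>The range stops before \<open>r - 1\<close>, so on the whole tree the last item
  \<open>n - 1\<close> never counts as own.\<close>

definition own_items :: "nat \<Rightarrow> nat \<Rightarrow> (point \<Rightarrow> nat) \<Rightarrow> nat \<Rightarrow> nat set" where
  "own_items l r c i = {j \<in> {l..<r - 1}. c (Item j) = c (Agent i)}"

text \<open>\<open>c\<close> assigns to a point the name of its cluster, namely the item at the node where the descent
  to the leaf \<open>a\<close> leaves that cluster behind.\<close>

definition clustering :: "nat \<Rightarrow> nat \<Rightarrow> nat \<Rightarrow> nat \<Rightarrow> (point \<Rightarrow> nat) \<Rightarrow> bool" where
  "clustering n l r a c \<longleftrightarrow> a \<in> {l..<r} \<and>
     (\<forall>i\<in>{l..<r} - {a}. c (Agent i) \<in> {l..<r - 1}) \<and>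
     (\<forall>j\<in>{l..<r - 1}. c (Item j) \<in> {l..<r - 1}) \<and>
     (\<forall>i\<in>{l..<r} - {a}. c (Item (shift_matching n a i)) = c (Agent i)) \<and>
     (\<forall>i\<in>{l..<r} - {a}. \<exists>u v. pref l r i = u @ v \<and> set u = own_items l r c i)"

text \<open>The descent enters the right half, and the left half with item \<open>m - 1\<close>
  becomes a new cluster. Names used in the right half are at least \<open>m\<close>, so the name
  \<open>m - 1\<close> is fresh and the old clusters survive.\<close>

lemma clustering_extend_left:
  assumes m: "m = (l + r) div 2" "l < m" "m < r" and c: "clustering n m r a c"
  defines "c' \<equiv> (\<lambda>x. if x \<in> Agent ` {l..<m} \<union> Item ` {l..<m} then m - 1 else c x)"
  shows "clustering n l r a c'"
    and "\<And>i. i \<in> {l..<m} \<Longrightarrow> own_items l r c' i = {l..<m}"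
    and "\<And>i. i \<in> {m..<r} - {a} \<Longrightarrow> own_items l r c' i = own_items m r c i"
proof -
  have a: "a \<in> {m..<r}"
    and ca: "\<And>i. i \<in> {m..<r} - {a} \<Longrightarrow> c (Agent i) \<in> {m..<r - 1}"
    and ci: "\<And>j. j \<in> {m..<r - 1} \<Longrightarrow> c (Item j) \<in> {m..<r - 1}"
    and cs: "\<And>i. i \<in> {m..<r} - {a} \<Longrightarrow> c (Item (shift_matching n a i)) = c (Agent i)"
    and cp: "\<And>i. i \<in> {m..<r} - {a} \<Longrightarrow> \<exists>u v. pref m r i = u @ v \<and> set u = own_items m r c i"
    using c unfolding clustering_def by blast+
  have c'A: "c' (Agent i) = (if l \<le> i \<and> i < m then m - 1 else c (Agent i))"
    and c'I: "c' (Item i) = (if l \<le> i \<and> i < m then m - 1 else c (Item i))" for i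
    by (auto simp: c'_def)
  have "j < m" if "c (Item j) = m - 1" "j < r - 1" for j
    using ci[of j] that m(2) by (cases "j < m") auto
  then show own1: "own_items l r c' i = {l..<m}" if "i \<in> {l..<m}" for i
    using that m(2,3) by (auto simp: own_items_def c'A c'I)
  show own2: "own_items l r c' i = own_items m r c i" if "i \<in> {m..<r} - {a}" for i
    using that m(2,3) ca[OF that] by (auto simp: own_items_def c'A c'I)
  have 1: "c' (Agent i) \<in> {l..<r - 1}" if "i \<in> {l..<r} - {a}" for i
    using that ca[of i] m(2,3) by (auto simp: c'A)
  have 2: "c' (Item i) \<in> {l..<r - 1}" if "i \<in> {l..<r - 1}" for i
    using that ci[of i] m(2,3) by (auto simp: c'I)
  have 3: "c' (Item (shift_matching n a i)) = c' (Agent i)" if i: "i \<in> {l..<r} - {a}" for i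
  proof (cases "i < m")
    case True
    then show ?thesis using i a by (auto simp: shift_matching_def c'A c'I)
  next
    case False
    \<comment> \<open>The index drops by one only for \<open>i > a\<close>, and
      \<open>a \<ge> m\<close>, so the partner stays in the right half.\<close>
    then have "shift_matching n a i \<ge> m" using i a by (auto simp: shift_matching_def)
    then show ?thesis using False i cs[of i] by (auto simp: c'A c'I)
  qed
  have 4: "\<exists>u v. pref l r i = u @ v \<and> set u = own_items l r c' i" if i: "i \<in> {l..<r} - {a}" for i
  proof (cases "i < m")
    case True
    have "pref l r i = (pref l m i @ [m - 1]) @ [m..<r - 1]"
      using pref_left[of l r i] m True by auto
    moreover have "set (pref l m i @ [m - 1]) = {l..<m}" using m(2) by (auto simp: set_pref)
    ultimately show ?thesis using own1[of i] True i by (metis Diff_iff atLeastLessThan_iff)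
  next
    case False
    then have im: "i \<in> {m..<r} - {a}" using i by auto
    then obtain u v where uv: "pref m r i = u @ v" "set u = own_items m r c i" using cp by blast
    \<comment> \<open>The list for the half is an initial segment of the larger list, so the old
      prefix of own items remains a prefix.\<close>
    have "pref l r i = (pref m r i @ [m - 1]) @ [l..<m - 1]"
      using pref_right[of l r i] m False by auto
    then have "pref l r i = u @ (v @ [m - 1] @ [l..<m - 1])" using uv by simp
    then show ?thesis using uv own2[OF im] by blast
  qed
  show "clustering n l r a c'"
    unfolding clustering_def using a m(2) 1 2 3 4 by auto
qed

text \<open>Mirror image: the descent enters the left half, whose names lie below
  \<open>m - 1\<close>. Item \<open>m - 1\<close> joins the right half, whose agents are all beyond
  \<open>a\<close> and hence are matched one index down, to \<open>{m - 1..<r - 1}\<close>.\<close>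

lemma clustering_extend_right:
  assumes m: "m = (l + r) div 2" "l < m" "m < r" and c: "clustering n l m a c"
  defines "c' \<equiv> (\<lambda>x. if x \<in> Agent ` {m..<r} \<union> Item ` {m - 1..<r - 1} then m - 1 else c x)"
  shows "clustering n l r a c'"
    and "\<And>i. i \<in> {m..<r} \<Longrightarrow> own_items l r c' i = {m - 1..<r - 1}"
    and "\<And>i. i \<in> {l..<m} - {a} \<Longrightarrow> own_items l r c' i = own_items l m c i"
proof -
  have a: "a \<in> {l..<m}"
    and ca: "\<And>i. i \<in> {l..<m} - {a} \<Longrightarrow> c (Agent i) \<in> {l..<m - 1}"
    and ci: "\<And>j. j \<in> {l..<m - 1} \<Longrightarrow> c (Item j) \<in> {l..<m - 1}"
    and cs: "\<And>i. i \<in> {l..<m} - {a} \<Longrightarrow> c (Item (shift_matching n a i)) = c (Agent i)"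
    and cp: "\<And>i. i \<in> {l..<m} - {a} \<Longrightarrow> \<exists>u v. pref l m i = u @ v \<and> set u = own_items l m c i"
    using c unfolding clustering_def by blast+
  have c'A: "c' (Agent i) = (if m \<le> i \<and> i < r then m - 1 else c (Agent i))"
    and c'I: "c' (Item i) = (if m - 1 \<le> i \<and> i < r - 1 then m - 1 else c (Item i))" for i
    by (auto simp: c'_def)
  have "m - 1 \<le> j" if "c (Item j) = m - 1" "l \<le> j" for j
    using ci[of j] that by (cases "j < m - 1") auto
  then show own1: "own_items l r c' i = {m - 1..<r - 1}" if "i \<in> {m..<r}" for i
    using that m(2,3) by (auto simp: own_items_def c'A c'I)
  show own2: "own_items l r c' i = own_items l m c i" if "i \<in> {l..<m} - {a}" for i
    using that m(2,3) ca[OF that] by (auto simp: own_items_def c'A c'I)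
  have 1: "c' (Agent i) \<in> {l..<r - 1}" if "i \<in> {l..<r} - {a}" for i
    using that ca[of i] m(2,3) by (auto simp: c'A)
  have 2: "c' (Item i) \<in> {l..<r - 1}" if "i \<in> {l..<r - 1}" for i
    using that ci[of i] m(2,3) by (auto simp: c'I)
  have 3: "c' (Item (shift_matching n a i)) = c' (Agent i)" if i: "i \<in> {l..<r} - {a}" for i
  proof (cases "i < m")
    case False
    then show ?thesis using i a by (auto simp: shift_matching_def c'A c'I)
  next
    case True
    then have "shift_matching n a i < m - 1" using i a by (auto simp: shift_matching_def)
    then show ?thesis using True i cs[of i] by (auto simp: c'A c'I)
  qed
  have 4: "\<exists>u v. pref l r i = u @ v \<and> set u = own_items l r c' i" if i: "i \<in> {l..<r} - {a}" for i
  proof (cases "i < m")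
    case False
    have "pref l r i = (pref m r i @ [m - 1]) @ [l..<m - 1]"
      using pref_right[of l r i] m False by auto
    moreover have "set (pref m r i @ [m - 1]) = {m - 1..<r - 1}"
      using m(2,3) by (auto simp: set_pref)
    moreover have "i \<in> {m..<r}" using False i by auto
    ultimately show ?thesis using own1[of i] by metis
  next
    case True
    then have im: "i \<in> {l..<m} - {a}" using i by auto
    then obtain u v where uv: "pref l m i = u @ v" "set u = own_items l m c i" using cp by blast
    have "pref l r i = (pref l m i @ [m - 1]) @ [m..<r - 1]"
      using pref_left[of l r i] m True by auto
    then have "pref l r i = u @ (v @ [m - 1] @ [m..<r - 1])" using uv by simp
    then show ?thesis using uv own2[OF im] by blast
  qed
  show "clustering n l r a c'"
    unfolding clustering_def using a m(3) 1 2 3 4 by auto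
qed

section \<open>Choosing the descent: a logarithmic number of gains\<close>

lemma cut_mass_Un:
  assumes "finite S" "finite T" "S \<inter> T = {}"
  shows "cut_mass n p (S \<union> T) Z = cut_mass n p S Z + cut_mass n p T Z"
  using assms by (simp add: cut_mass_def sum.union_disjoint)

lemma cut_mass_cong:
  assumes "\<And>i. i \<in> S \<Longrightarrow> Z i = Z' i"
  shows "cut_mass n p S Z = cut_mass n p S Z'"
  using assms by (simp add: cut_mass_def)

text \<open>Origin of the constant 1/4: a level of the descent gains 1/2 and divides the size by at
  most 3, and \<open>ln 3 / 4 \<le> 1 / 2\<close>.\<close>

lemma ln_le_of_le_triple:
  assumes "0 < s" "real t \<le> 3 * real s" "0 < t"
  shows "ln (real t) / 4 \<le> 1 / 2 + ln (real s) / 4"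
proof -
  have "ln (real t) \<le> ln (3 * real s)" using assms by simp
  also have "\<dots> = ln 3 + ln (real s)" using assms by (simp add: ln_mult)
  also have "ln (3::real) \<le> 2" using ln_le_minus_one[of "3::real"] by simp
  finally show ?thesis by simp
qed

lemma exists_costly_clustering:
  assumes p: "fractional_matching n p" and "l < r" "r \<le> n"
  shows "\<exists>a c. clustering n l r a c \<and>
    ln (real (r - l)) / 4 \<le> cut_mass n p ({l..<r} - {a}) (own_items l r c)"
  using assms(2,3)
proof (induction "r - l" arbitrary: l r rule: less_induct)
  case less
  define m where "m = (l + r) div 2"
  show ?case
  proof (cases "r = Suc l")
    case True
    then show ?thesis
      by (intro exI[of _ l] exI[of _ "\<lambda>_. 0"]) (auto simp: clustering_def cut_mass_def)
  next
    case False
    then have m: "l < m" "m < r" using less.prems by (auto simp: m_def)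
    \<comment> \<open>The half that exports at least 1/2 becomes the cluster, and the induction
      continues in the other half.\<close>
    consider (L) "1 / 2 \<le> cut_mass n p {l..<m} (\<lambda>_. {l..<m})"
      | (R) "1 / 2 \<le> cut_mass n p {m..<r} (\<lambda>_. {m - 1..<r - 1})"
      using cut_mass_two_halves[OF p m less.prems(2)] by linarith
    then show ?thesis
    proof cases
      case L
      obtain a c where c: "clustering n m r a c"
        and le: "ln (real (r - m)) / 4 \<le> cut_mass n p ({m..<r} - {a}) (own_items m r c)"
        using less.hyps[OF diff_less_mono2[OF m(1) less.prems(1)] m(2) less.prems(2)] by blast
      define c' where "c' = (\<lambda>x. if x \<in> Agent ` {l..<m} \<union> Item ` {l..<m} then m - 1 else c x)"
      note ext = clustering_extend_left[OF m_def m c, folded c'_def]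
      have "a \<in> {m..<r}" using c by (simp add: clustering_def)
      then have split: "{l..<r} - {a} = {l..<m} \<union> ({m..<r} - {a})" using m by auto
      have "cut_mass n p ({l..<r} - {a}) (own_items l r c') =
          cut_mass n p {l..<m} (own_items l r c') + cut_mass n p ({m..<r} - {a}) (own_items l r c')"
        unfolding split by (intro cut_mass_Un) auto
      moreover have "cut_mass n p {l..<m} (own_items l r c') = cut_mass n p {l..<m} (\<lambda>_. {l..<m})"
        using ext(2) by (intro cut_mass_cong) auto
      moreover have "cut_mass n p ({m..<r} - {a}) (own_items l r c') =
          cut_mass n p ({m..<r} - {a}) (own_items m r c)"
        using ext(3) by (intro cut_mass_cong) auto
      moreover have "real (r - l) \<le> 3 * real (r - m)" unfolding m_def using m by simp
      then have "ln (real (r - l)) / 4 \<le> 1 / 2 + ln (real (r - m)) / 4"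
        using m by (intro ln_le_of_le_triple) auto
      ultimately show ?thesis using ext(1) L le by (intro exI[of _ a] exI[of _ c']) simp
    next
      case R
      obtain a c where c: "clustering n l m a c"
        and le: "ln (real (m - l)) / 4 \<le> cut_mass n p ({l..<m} - {a}) (own_items l m c)"
        using less.hyps[of m l] diff_less_mono[OF m(2) less_imp_le[OF m(1)]] m less.prems(2)
        by (meson less_imp_le order_trans)
      define c' where
        "c' = (\<lambda>x. if x \<in> Agent ` {m..<r} \<union> Item ` {m - 1..<r - 1} then m - 1 else c x)"
      note ext = clustering_extend_right[OF m_def m c, folded c'_def]
      have "a \<in> {l..<m}" using c by (simp add: clustering_def)
      then have split: "{l..<r} - {a} = {m..<r} \<union> ({l..<m} - {a})" using m by auto
      have "cut_mass n p ({l..<r} - {a}) (own_items l r c') =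
          cut_mass n p {m..<r} (own_items l r c') + cut_mass n p ({l..<m} - {a}) (own_items l r c')"
        unfolding split by (intro cut_mass_Un) auto
      moreover have "cut_mass n p {m..<r} (own_items l r c') =
          cut_mass n p {m..<r} (\<lambda>_. {m - 1..<r - 1})"
        using ext(2) by (intro cut_mass_cong) auto
      moreover have "cut_mass n p ({l..<m} - {a}) (own_items l r c') =
          cut_mass n p ({l..<m} - {a}) (own_items l m c)"
        using ext(3) by (intro cut_mass_cong) auto
      moreover have "m - l = (r - l) div 2" using less.prems(1) by (simp add: m_def)
      \<comment> \<open>The left half is rounded down; the ratio 3 is attained at
        \<open>r - l = 3\<close>.\<close>
      then have "r - l \<le> 3 * (m - l)" using m by linarith
      then have "real (r - l) \<le> 3 * real (m - l)" by linarith
      then have "ln (real (r - l)) / 4 \<le> 1 / 2 + ln (real (m - l)) / 4"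
        using m by (intro ln_le_of_le_triple) auto
      ultimately show ?thesis using ext(1) R le by (intro exI[of _ a] exI[of _ c']) simp
    qed
  qed
qed

section \<open>The 0/1 metric and the distortion bound\<close>

definition tree_instance :: "nat \<Rightarrow> nat list list" where
  "tree_instance n = map (\<lambda>i. pref 0 n i @ [n - 1]) [0..<n]"

lemma is_instance_tree_instance:
  assumes "0 < n"
  shows "is_instance n (tree_instance n)"
  using assms by (auto simp: is_instance_def tree_instance_def set_pref distinct_pref)

lemma perfect_matching_shift_matching:
  assumes "a < n"
  shows "perfect_matching n (shift_matching n a)"
proof -
  have "inj_on (shift_matching n a) {..<n}"
    using assms by (auto simp: inj_on_def shift_matching_def split: if_splits)
  moreover have "shift_matching n a ` {..<n} \<subseteq> {..<n}"
    using assms by (auto simp: shift_matching_def)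
  ultimately show ?thesis
    by (simp add: perfect_matching_def bij_betw_def endo_inj_surj)
qed

lemma distortion_witness:
  assumes p: "fractional_matching n p" and n: "0 < n"
  shows "\<exists>d M. is_metric n d \<and> consistent n (tree_instance n) d \<and> min_cost_matching n d M \<and>
    cost n d M = 1 \<and> ln (real n) / 4 \<le> fractional_cost n d p"
proof -
  obtain a c0 where c0: "clustering n 0 n a c0"
    and le: "ln (real n) / 4 \<le> cut_mass n p ({0..<n} - {a}) (own_items 0 n c0)"
    using exists_costly_clustering[OF p n order_refl] by auto
  \<comment> \<open>All other names are below \<open>n - 1\<close>, so agent \<open>a\<close> and
    item \<open>n - 1\<close> become singleton clusters.\<close>
  define c where "c = c0(Agent a := n, Item (n - 1) := n - 1)"
  define d where "d x y = (if c x = c y then 0 else 1 :: real)" for x y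
  let ?M = "shift_matching n a"
  have a: "a < n"
    and ca: "\<And>i. i < n \<Longrightarrow> i \<noteq> a \<Longrightarrow> c0 (Agent i) < n - 1"
    and ci: "\<And>j. j < n - 1 \<Longrightarrow> c0 (Item j) < n - 1"
    and cs: "\<And>i. i < n \<Longrightarrow> i \<noteq> a \<Longrightarrow> c0 (Item (?M i)) = c0 (Agent i)"
    and cp: "\<And>i. i < n \<Longrightarrow> i \<noteq> a \<Longrightarrow> \<exists>u v. pref 0 n i = u @ v \<and> set u = own_items 0 n c0 i"
    using c0 unfolding clustering_def by auto
  \<comment> \<open>Being equidistant from all items makes any list of \<open>a\<close> consistent
    and forces every perfect matching to cost at least 1.\<close>
  have d_a: "d (Agent a) (Item j) = 1" if "j < n" for j
    using that n ci[of j] by (cases "j < n - 1") (auto simp: d_def c_def)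
  have d_own: "d (Agent i) (Item j) = (if j \<in> own_items 0 n c0 i then 0 else 1)"
    if "i < n" "i \<noteq> a" "j < n" for i j
    using that ca[of i] by (cases "j = n - 1") (auto simp: d_def c_def own_items_def)
  have metric: "is_metric n d" by (auto simp: is_metric_def d_def)
  have "consistent n (tree_instance n) d"
    unfolding consistent_def
  proof (intro allI impI)
    fix i r s assume i: "i < n" and rs: "r < s \<and> s < n"
    let ?L = "tree_instance n ! i"
    have L: "?L = pref 0 n i @ [n - 1]" using i by (simp add: tree_instance_def)
    have inst: "?L \<in> set (tree_instance n)" using i by (simp add: tree_instance_def)
    then have setL: "set ?L = {..<n}" and distL: "distinct ?L"
      using is_instance_tree_instance[OF n] by (auto simp: is_instance_def)
    then have len: "length ?L = n" by (metis distinct_card card_lessThan)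
    have lt: "?L ! r < n" "?L ! s < n" using setL len rs by (metis lessThan_iff nth_mem order_less_trans)+
    show "d (Agent i) (Item (?L ! r)) \<le> d (Agent i) (Item (?L ! s))"
    proof (cases "i = a")
      case True
      then show ?thesis using lt by (simp add: d_a)
    next
      case False
      then obtain u v where uv: "pref 0 n i = u @ v" "set u = own_items 0 n c0 i"
        using cp i by blast
      have Luv: "?L = u @ (v @ [n - 1])" using L uv by simp
      \<comment> \<open>Distances along the list are 0 on the prefix \<open>u\<close> and 1
        afterwards. Distinctness identifies \<open>s\<close> with a position inside
        \<open>u\<close>, and \<open>r\<close> precedes it.\<close>
      have "?L ! r \<in> set u" if "?L ! s \<in> set u"
      proof -
        obtain t where t: "t < length u" "u ! t = ?L ! s" using \<open>?L ! s \<in> set u\<close>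
          by (meson in_set_conv_nth)
        then have "?L ! t = ?L ! s" "t < n" using Luv len by (auto simp: nth_append)
        then have "t = s" using distL len rs by (simp add: nth_eq_iff_index_eq)
        then show ?thesis using t rs Luv by (simp add: nth_append)
      qed
      then show ?thesis using uv lt i False by (simp add: d_own)
    qed
  qed
  moreover have cost_M: "cost n d ?M = 1"
  proof -
    have "d (Agent i) (Item (?M i)) = (if i = a then 1 else 0)" if "i < n" for i
    proof (cases "i = a")
      case True
      then show ?thesis using d_a[of "?M a"] n by (simp add: shift_matching_def)
    next
      case False
      then have "?M i < n - 1" using that a by (auto simp: shift_matching_def)
      then show ?thesis using False that cs[of i] by (simp add: d_own own_items_def)
    qed
    then show ?thesis using a by (simp add: cost_def)
  qed
  moreover have "min_cost_matching n d ?M"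
    unfolding min_cost_matching_def
  proof (intro conjI allI impI)
    show "perfect_matching n ?M" using a by (rule perfect_matching_shift_matching)
    fix M' assume "perfect_matching n M'"
    then have "M' a < n" using a by (auto simp: perfect_matching_def bij_betw_def)
    then have "1 = d (Agent a) (Item (M' a))" by (simp add: d_a)
    also have "\<dots> \<le> cost n d M'"
      unfolding cost_def using a by (intro member_le_sum) (auto simp: d_def)
    finally show "cost n d ?M \<le> cost n d M'" using cost_M by simp
  qed
  moreover have "cut_mass n p ({0..<n} - {a}) (own_items 0 n c0) \<le> fractional_cost n d p"
  proof -
    have "cut_mass n p ({0..<n} - {a}) (own_items 0 n c0) =
        (\<Sum>i\<in>{..<n} - {a}. \<Sum>j<n. p i j * d (Agent i) (Item j))"
      unfolding cut_mass_def
      \<comment> \<open>Own items contribute 0 and all others their full mass; the next step adds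
        back the nonnegative row of \<open>a\<close>.\<close>
      by (intro sum.cong sum.mono_neutral_cong_left) (auto simp: d_own)
    also have "\<dots> \<le> fractional_cost n d p"
      unfolding fractional_cost_def using a p
      by (intro sum_mono2) (auto simp: d_def fractional_matching_def intro!: sum_nonneg)
    finally show ?thesis .
  qed
  ultimately show ?thesis using metric le by (intro exI[of _ d] exI[of _ ?M]) simp
qed

theorem mainTheorem2:
  shows "\<exists>c::real. c > 0 \<and>
    (\<forall>n\<ge>2. \<forall>f. randomized_mechanism n f \<longrightarrow>
      (\<exists>P d M. is_instance n P \<and> is_metric n d \<and> consistent n P d \<and>
        min_cost_matching n d M \<and> cost n d M > 0 \<and>
        fractional_cost n d (f P) \<ge> c * ln (real n) * cost n d M))"
proof (intro exI[of _ "1 / 4"] conjI allI impI)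
  fix n :: nat and f :: "nat list list \<Rightarrow> nat \<Rightarrow> nat \<Rightarrow> real"
  assume n: "2 \<le> n" and f: "randomized_mechanism n f"
  \<comment> \<open>One instance serves all mechanisms; only the metric is adapted to the output
    \<open>f (tree_instance n)\<close>.\<close>
  have inst: "is_instance n (tree_instance n)" using n by (intro is_instance_tree_instance) simp
  then have "fractional_matching n (f (tree_instance n))"
    using f by (simp add: randomized_mechanism_def)
  then obtain d M where "is_metric n d" "consistent n (tree_instance n) d"
    "min_cost_matching n d M" "cost n d M = 1"
    "ln (real n) / 4 \<le> fractional_cost n d (f (tree_instance n))"
    using distortion_witness n by (metis gr0I not_numeral_le_zero)
  then show "\<exists>P d M. is_instance n P \<and> is_metric n d \<and> consistent n P d \<and>
        min_cost_matching n d M \<and> cost n d M > 0 \<and>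
        fractional_cost n d (f P) \<ge> 1 / 4 * ln (real n) * cost n d M"
    using inst by (intro exI[of _ "tree_instance n"] exI[of _ d] exI[of _ M]) simp
qed simp

end
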